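(* Let $H$ be a Hadamard matrix of order $n$, and for $m\in\{2,3\}$ let $Z(m,H)$ be the number of zero minors of order $m$ of $H$. Then $$Z(2,H) = \frac{n^2(n-1)(n-2)}{8}$$ and $$Z(3,H) = \frac{n^2(n-1)(n-2)(n-4)(5n-4)}{288}.$$
   Context: A Hadamard matrix of order $n$ is an $n\times n$ matrix $H$ with entries in $\{+1,-1\}$ satisfying $HH^T = nI$. A minor of order $m$ of $H$ is the determinant of an $m\times m$ submatrix of $H$, obtained by choosing $m$ of the rows and $m$ of the columns of $H$ (not necessarily consecutive). Minors are counted by the choice of rows and columns, so there are $\binom{n}{m}^2$ minors of order $m$ in total (in particular none if $m>n$). *)

theory Defs
  imports
    Complex_Main
    "Jordan_Normal_Form.Determinant"
    "Jordan_Normal_Form.DL_Submatrix"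
begin

definition hadamard_matrix :: "nat \<Rightarrow> real mat \<Rightarrow> bool" where
  "hadamard_matrix n H \<longleftrightarrow>
     H \<in> carrier_mat n n \<and>
     (\<forall>i<n. \<forall>j<n. H $$ (i, j) \<in> {1, -1}) \<and>
     H * transpose_mat H = real n \<cdot>\<^sub>m 1\<^sub>m n"

text \<open>
  A minor is indexed by the pair of its row set and column set, so minors of equal value
  in different positions are counted separately.
\<close>

definition minor_positions :: "nat \<Rightarrow> 'a mat \<Rightarrow> (nat set \<times> nat set) set" where
  "minor_positions m A =
     {(I, J). I \<subseteq> {..<dim_row A} \<and> card I = m \<and> J \<subseteq> {..<dim_col A} \<and> card J = m}"

definition num_zero_minors :: "nat \<Rightarrow> 'a :: comm_ring_1 mat \<Rightarrow> nat" where
  "num_zero_minors m A = card {(I, J) \<in> minor_positions m A. det (submatrix A I J) = 0}"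

end

theory Submission
  imports Defs
begin

text \<open>
  By Cauchy-Binet and the orthogonality of the rows, the squares of the minors of order \<open>m\<close>
  taken from any fixed \<open>m\<close> rows sum to \<open>n ^ m\<close>. For \<open>m = 2\<close> and \<open>m = 3\<close> a
  nonzero minor of a sign matrix has absolute value 2 and 4 respectively, so this sum of squares
  determines the number of nonzero minors.
\<close>

section \<open>Increasing enumerations and injections\<close>

lemma pick_le_of_subset:
  assumes "J \<subseteq> {..<n}" "i < card J"
  shows "pick J i < n"
  using assms pick_in_set_le by blast

text \<open>The counted set misses \<open>a\<close> itself. This keeps ranks within an
  \<open>m\<close>-element set below \<open>m\<close>.\<close>

lemma card_less_in_set_less_card:
  fixes J :: "'a :: preorder set"
  assumes "finite J" "a \<in> J"
  shows "card {b \<in> J. b < a} < card J"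
  using assms by (intro psubset_card_mono) auto

text \<open>
  An injection of \<open>{0..<m}\<close> into \<open>{..<n}\<close> is a permutation followed by the
  increasing enumeration of its image.
\<close>
lemma sum_inj_funs_eq_sum_subsets_permutations:
  fixes F :: "(nat \<Rightarrow> nat) \<Rightarrow> 'a :: comm_monoid_add"
  shows "(\<Sum>g | g \<in> {0..<m} \<rightarrow>\<^sub>E {..<n} \<and> inj_on g {0..<m}. F g)
    = (\<Sum>J | J \<subseteq> {..<n} \<and> card J = m. \<Sum>p | p permutes {0..<m}.
         F (\<lambda>i\<in>{0..<m}. pick J (p i)))"
proof -
  let ?S = "{0..<m}"
  let ?Js = "{J. J \<subseteq> {..<n} \<and> card J = m}"
  let ?Ps = "{p. p permutes ?S}"
  \<comment> \<open>The permutation part of \<open>g\<close>: the position of \<open>g i\<close> in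
    the ordered image. Outside the index range it is the identity, as \<open>permutes\<close>
    demands.\<close>
  define rank where "rank g i = (if i < m then card {a \<in> g ` ?S. a < g i} else i)"
    for g :: "nat \<Rightarrow> nat" and i
  have fin: "finite ?Js" "finite ?Ps"
    by (auto intro: finite_subset[of _ "Pow {..<n}"] finite_permutations)
  have lt: "p i < m" if "p permutes ?S" "i < m" for p i
    using permutes_in_image[OF that(1), of i] that(2) by simp
  have pick_rank: "pick (g ` ?S) (rank g i) = g i" if "i < m" for g i
    using that pick_card_in_set[of "g i" "g ` ?S"] by (simp add: rank_def)
  have inj_pick: "i = j" if "i < card J" "j < card J" "pick J i = pick J j" for i j J
    using that by (metis card_pick_le)
  have range_pick: "pick J ` ?S = J" if "J \<in> ?Js" for J
  proof -
    have "finite J" using that finite_subset by blast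
    moreover have "pick J ` ?S \<subseteq> J" using that pick_in_set_le by auto
    moreover have "inj_on (pick J) ?S" using that inj_pick by (auto intro!: inj_onI)
    ultimately show ?thesis using that by (intro card_subset_eq) (auto simp: card_image)
  qed
  \<comment> \<open>Since \<open>p\<close> only reorders the indices, the image of the composite
    gives back \<open>J\<close>.\<close>
  have image: "(\<lambda>i\<in>?S. pick J (p i)) ` ?S = J" if "J \<in> ?Js" "p \<in> ?Ps" for J p
  proof -
    have "(\<lambda>i\<in>?S. pick J (p i)) ` ?S = pick J ` p ` ?S" by (simp add: image_image)
    also have "p ` ?S = ?S" using that permutes_image by blast
    finally show ?thesis using range_pick[OF that(1)] by simp
  qed
  have "(\<Sum>g | g \<in> ?S \<rightarrow>\<^sub>E {..<n} \<and> inj_on g ?S. F g)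
      = (\<Sum>(J, p) \<in> ?Js \<times> ?Ps. F (\<lambda>i\<in>?S. pick J (p i)))"
  proof (rule sum.reindex_bij_witness[where i = "\<lambda>(J, p). \<lambda>i\<in>?S. pick J (p i)"
        and j = "\<lambda>g. (g ` ?S, rank g)"], goal_cases)
    case (1 g)
    \<comment> \<open>The equality of functions must also hold outside \<open>?S\<close>, where both
      the extensional \<open>g\<close> and the restricted lambda are
      \<open>undefined\<close>.\<close>
    then have "g i = undefined" if "i \<notin> ?S" for i
      using that by (auto simp: PiE_def extensional_def)
    then show ?case using pick_rank by (auto simp: fun_eq_iff)
  next
    case (2 g)
    then have g: "g ` ?S \<subseteq> {..<n}" "card (g ` ?S) = m" "inj_on g ?S"
      by (auto simp: card_image)
    have "rank g ` ?S \<subseteq> ?S"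
      using card_less_in_set_less_card[of "g ` ?S"] g(2) by (auto simp: rank_def)
    moreover have "inj_on (rank g) ?S"
    proof (rule inj_onI)
      fix i j assume ij: "i \<in> ?S" "j \<in> ?S" "rank g i = rank g j"
      then have "g i = g j" using pick_rank[of i g] pick_rank[of j g] by simp
      then show "i = j" using g(3) ij(1,2) by (auto dest: inj_onD)
    qed
    ultimately have "bij_betw (rank g) ?S ?S"
      unfolding bij_betw_def using endo_inj_surj[of ?S "rank g"] by blast
    then have "rank g permutes ?S" by (rule bij_imp_permutes) (simp add: rank_def)
    then show ?case using g by auto
  next
    case (3 Jp)
    then obtain J p where Jp: "Jp = (J, p)" "J \<in> ?Js" "p \<in> ?Ps" by auto
    \<comment> \<open>Exactly \<open>p i\<close> elements of \<open>J\<close> lie below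
      \<open>pick J (p i)\<close>, so the rank reads \<open>p\<close> back.\<close>
    have "rank (\<lambda>i\<in>?S. pick J (p i)) i = p i" for i
    proof (cases "i \<in> ?S")
      case True
      then have "card {a \<in> J. a < pick J (p i)} = p i"
        using Jp lt[of p i] by (intro card_pick_le) auto
      then show ?thesis using True image[OF Jp(2,3)] by (simp add: rank_def)
    next
      case False
      then show ?thesis using Jp(3) permutes_not_in[of p ?S i] by (simp add: rank_def)
    qed
    then show ?case using image[OF Jp(2,3)] Jp(1) by (auto simp: fun_eq_iff)
  next
    case (4 Jp)
    then obtain J p where Jp: "Jp = (J, p)" "J \<in> ?Js" "p \<in> ?Ps" by auto
    have "(\<lambda>i\<in>?S. pick J (p i)) \<in> ?S \<rightarrow>\<^sub>E {..<n}"
      using Jp lt by (auto intro!: pick_le_of_subset)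
    moreover have "inj_on (\<lambda>i\<in>?S. pick J (p i)) ?S"
      using image[OF Jp(2,3)] Jp(2) by (intro eq_card_imp_inj_on) auto
    ultimately show ?case using Jp(1) by simp
  next
    case (5 g)
    then have "g i = undefined" if "i \<notin> ?S" for i
      using that by (auto simp: PiE_def extensional_def)
    then have "(\<lambda>i\<in>?S. pick (g ` ?S) (rank g i)) = g" using pick_rank by (auto simp: fun_eq_iff)
    then show ?case by simp
  qed
  then show ?thesis using fin by (simp add: sum.cartesian_product)
qed

section \<open>The Cauchy-Binet formula\<close>

text \<open>Expand the product by choosing a summation index \<open>g i\<close> for each row
  \<open>i\<close>, discard the non-injective choices, and group the others by their image
  \<open>J\<close>. For \<open>m > n\<close> no injective choice exists and the sum is
  empty.\<close>

theorem cauchy_binet: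
  fixes A B :: "'a :: comm_ring_1 mat"
  assumes A: "A \<in> carrier_mat m n" and B: "B \<in> carrier_mat n m"
  shows "det (A * B) = (\<Sum>J | J \<subseteq> {..<n} \<and> card J = m.
    det (submatrix A UNIV J) * det (submatrix B J UNIV))"
proof -
  let ?S = "{0..<m}"
  let ?P = "{p. p permutes ?S}"
  let ?rows = "\<lambda>g. mat m m (\<lambda>(i, j). B $$ (g i, j))"
  have lt: "p i < m" if "p permutes ?S" "i < m" for p i
    using permutes_in_image[OF that(1), of i] that(2) by simp
  have fin: "finite (?S \<rightarrow>\<^sub>E {..<n})" by (intro finite_PiE) auto
  have "det (A * B) = (\<Sum>p\<in>?P. signof p * (\<Prod>i\<in>?S. \<Sum>k\<in>{..<n}. A $$ (i, k) * B $$ (k, p i)))"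
  proof -
    have "(A * B) $$ (i, p i) = (\<Sum>k\<in>{..<n}. A $$ (i, k) * B $$ (k, p i))"
      if "p permutes ?S" "i < m" for p i
      using A B lt[OF that] that(2) by (simp add: scalar_prod_def lessThan_atLeast0)
    then show ?thesis
      using A B by (subst det_def'[of _ m]) (auto intro!: sum.cong prod.cong)
  qed
  also have "\<dots> = (\<Sum>p\<in>?P. \<Sum>g\<in>?S \<rightarrow>\<^sub>E {..<n}.
      (\<Prod>i\<in>?S. A $$ (i, g i)) * (signof p * (\<Prod>i\<in>?S. B $$ (g i, p i))))"
    by (simp add: prod_sum_PiE sum_distrib_left prod.distrib mult_ac)
  \<comment> \<open>For fixed \<open>g\<close>, the sum over \<open>p\<close> is the Leibniz
    expansion for the matrix whose row \<open>i\<close> is row \<open>g i\<close> of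
    \<open>B\<close>.\<close>
  also have "\<dots> = (\<Sum>g\<in>?S \<rightarrow>\<^sub>E {..<n}. (\<Prod>i\<in>?S. A $$ (i, g i)) * det (?rows g))"
  proof (subst sum.swap, rule sum.cong[OF refl])
    fix g
    have "det (?rows g) = (\<Sum>p\<in>?P. signof p * (\<Prod>i\<in>?S. B $$ (g i, p i)))"
      using lt by (subst det_def'[of _ m]) (auto intro!: sum.cong prod.cong)
    then show "(\<Sum>p\<in>?P. (\<Prod>i\<in>?S. A $$ (i, g i)) * (signof p * (\<Prod>i\<in>?S. B $$ (g i, p i))))
        = (\<Prod>i\<in>?S. A $$ (i, g i)) * det (?rows g)"
      by (simp add: sum_distrib_left)
  qed
  \<comment> \<open>If \<open>g\<close> repeats a value, then \<open>?rows g\<close> has two equal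
    rows and its determinant vanishes.\<close>
  also have "\<dots> = (\<Sum>g | g \<in> ?S \<rightarrow>\<^sub>E {..<n} \<and> inj_on g ?S. (\<Prod>i\<in>?S. A $$ (i, g i)) * det (?rows g))"
  proof (rule sum.mono_neutral_right[OF fin], goal_cases)
    case 2
    show ?case
    proof
      fix g assume "g \<in> (?S \<rightarrow>\<^sub>E {..<n}) - {g. g \<in> ?S \<rightarrow>\<^sub>E {..<n} \<and> inj_on g ?S}"
      then obtain i j where ij: "i < m" "j < m" "i \<noteq> j" "g i = g j" by (auto simp: inj_on_def)
      have "det (?rows g) = 0"
        by (rule det_identical_rows[OF _ ij(3,1,2)]) (use ij in auto)
      then show "(\<Prod>i\<in>?S. A $$ (i, g i)) * det (?rows g) = 0" by simp
    qed
  qed auto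
  also have "\<dots> = (\<Sum>J | J \<subseteq> {..<n} \<and> card J = m. \<Sum>p\<in>?P.
      (\<Prod>i\<in>?S. A $$ (i, (\<lambda>i\<in>?S. pick J (p i)) i)) * det (?rows (\<lambda>i\<in>?S. pick J (p i))))"
    by (rule sum_inj_funs_eq_sum_subsets_permutations)
  also have "\<dots> = (\<Sum>J | J \<subseteq> {..<n} \<and> card J = m.
      det (submatrix A UNIV J) * det (submatrix B J UNIV))"
  proof (rule sum.cong[OF refl])
    fix J assume "J \<in> {J. J \<subseteq> {..<n} \<and> card J = m}"
    then have J: "J \<subseteq> {..<n}" "card J = m" by auto
    then have "{j. j < n \<and> j \<in> J} = J" by auto
    then have cJ: "card {j. j < n \<and> j \<in> J} = m" using J(2) by simp
    have subA: "submatrix A UNIV J = mat m m (\<lambda>(i, j). A $$ (i, pick J j))"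
      and subB: "submatrix B J UNIV = mat m m (\<lambda>(i, j). B $$ (pick J i, j))"
      using A B cJ by (simp_all add: submatrix_def pick_UNIV)
    \<comment> \<open>The rows of \<open>B\<close> indexed by \<open>J\<close> appear in the order
      given by \<open>p\<close>, which costs only the sign. The remaining signed sum over
      \<open>p\<close> is the Leibniz expansion on the side of \<open>A\<close>.\<close>
    have "det (?rows (\<lambda>i\<in>?S. pick J (p i))) = signof p * det (submatrix B J UNIV)"
      if "p \<in> ?P" for p
    proof -
      have "?rows (\<lambda>i\<in>?S. pick J (p i)) = mat m m (\<lambda>(i, j). submatrix B J UNIV $$ (p i, j))"
        using lt that by (intro eq_matI) (auto simp: subB)
      then show ?thesis
        using that by (simp add: det_permute_rows[of _ m] subB)
    qed
    then have "(\<Sum>p\<in>?P. (\<Prod>i\<in>?S. A $$ (i, (\<lambda>i\<in>?S. pick J (p i)) i))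
          * det (?rows (\<lambda>i\<in>?S. pick J (p i))))
        = (\<Sum>p\<in>?P. signof p * (\<Prod>i\<in>?S. A $$ (i, pick J (p i)))) * det (submatrix B J UNIV)"
      by (simp add: sum_distrib_left sum_distrib_right mult_ac)
    also have "(\<Sum>p\<in>?P. signof p * (\<Prod>i\<in>?S. A $$ (i, pick J (p i)))) = det (submatrix A UNIV J)"
      unfolding subA using lt
      by (subst det_def'[of _ m]) (auto intro!: sum.cong prod.cong)
    finally show "(\<Sum>p\<in>?P. (\<Prod>i\<in>?S. A $$ (i, (\<lambda>i\<in>?S. pick J (p i)) i))
          * det (?rows (\<lambda>i\<in>?S. pick J (p i))))
        = det (submatrix A UNIV J) * det (submatrix B J UNIV)" .
  qed
  finally show ?thesis .
qed

section \<open>Squared minors of a Hadamard matrix\<close>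

lemma submatrix_carrier:
  assumes "I \<subseteq> {..<dim_row A}" "card I = k" "J \<subseteq> {..<dim_col A}" "card J = l"
  shows "submatrix A I J \<in> carrier_mat k l"
proof -
  have "{i. i < dim_row A \<and> i \<in> I} = I" "{j. j < dim_col A \<and> j \<in> J} = J" using assms by auto
  then show ?thesis using assms(2,4) by (intro carrier_matI) (simp_all add: dim_submatrix)
qed

lemma hadamard_rows_orthogonal:
  assumes "hadamard_matrix n H" "i < n" "j < n"
  shows "(\<Sum>k<n. H $$ (i, k) * H $$ (j, k)) = (if i = j then real n else 0)"
proof -
  have H: "H \<in> carrier_mat n n" "H * transpose_mat H = real n \<cdot>\<^sub>m 1\<^sub>m n"
    using assms(1) by (auto simp: hadamard_matrix_def)
  have "(\<Sum>k<n. H $$ (i, k) * H $$ (j, k)) = (H * transpose_mat H) $$ (i, j)"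
    using H(1) assms(2,3) by (simp add: scalar_prod_def lessThan_atLeast0)
  also have "\<dots> = (if i = j then real n else 0)" using assms(2,3) by (simp add: H(2))
  finally show ?thesis .
qed

text \<open>The chosen rows form an \<open>m\<close> by \<open>n\<close> matrix \<open>A\<close>
  whose Gram matrix is \<open>n\<close> times the identity, with determinant \<open>n ^ m\<close>.
  Cauchy-Binet for \<open>A\<close> and its transpose writes this determinant as a sum of
  squares.\<close>

lemma hadamard_sum_minors_squared:
  assumes H: "hadamard_matrix n H" and I: "I \<subseteq> {..<n}" "card I = m"
  shows "(\<Sum>J | J \<subseteq> {..<n} \<and> card J = m. (det (submatrix H I J))\<^sup>2) = real n ^ m"
proof -
  have dim: "H \<in> carrier_mat n n" using H by (simp add: hadamard_matrix_def)
  define A where "A = mat m n (\<lambda>(i, j). H $$ (pick I i, j))"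
  have A: "A \<in> carrier_mat m n" by (simp add: A_def)
  have "A * transpose_mat A = real n \<cdot>\<^sub>m 1\<^sub>m m"
  proof (rule eq_matI)
    fix i j assume "i < dim_row (real n \<cdot>\<^sub>m 1\<^sub>m m)" "j < dim_col (real n \<cdot>\<^sub>m 1\<^sub>m m)"
    then have ij: "i < m" "j < m" by auto
    then have "(A * transpose_mat A) $$ (i, j) = (\<Sum>k<n. H $$ (pick I i, k) * H $$ (pick I j, k))"
      by (simp add: A_def scalar_prod_def lessThan_atLeast0)
    also have "\<dots> = (if pick I i = pick I j then real n else 0)"
      using ij I by (intro hadamard_rows_orthogonal[OF H] pick_le_of_subset) auto
    \<comment> \<open>The index \<open>i\<close> is recovered from \<open>pick I i\<close> as the
      number of elements of \<open>I\<close> below it.\<close>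
    also have "pick I i = pick I j \<longleftrightarrow> i = j" using ij I(2) by (metis card_pick_le)
    finally show "(A * transpose_mat A) $$ (i, j) = (real n \<cdot>\<^sub>m 1\<^sub>m m) $$ (i, j)" using ij by simp
  qed (simp_all add: A_def)
  then have "real n ^ m = det (A * transpose_mat A)" by simp
  also have "\<dots> = (\<Sum>J | J \<subseteq> {..<n} \<and> card J = m.
      det (submatrix A UNIV J) * det (submatrix (transpose_mat A) J UNIV))"
    using A by (intro cauchy_binet) auto
  also have "\<dots> = (\<Sum>J | J \<subseteq> {..<n} \<and> card J = m. (det (submatrix H I J))\<^sup>2)"
  proof (rule sum.cong[OF refl])
    fix J assume "J \<in> {J. J \<subseteq> {..<n} \<and> card J = m}"
    then have J: "J \<subseteq> {..<n}" "card J = m" by auto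
    have cIJ: "{i. i < n \<and> i \<in> I} = I" "{j. j < n \<and> j \<in> J} = J" using I J by auto
    have sub: "submatrix A UNIV J = submatrix H I J"
      using dim I J by (auto intro!: eq_matI simp: submatrix_def A_def pick_UNIV cIJ pick_le_of_subset)
    moreover have "submatrix (transpose_mat A) J UNIV = transpose_mat (submatrix A UNIV J)"
      using I J by (auto intro!: eq_matI simp: submatrix_def A_def pick_UNIV cIJ pick_le_of_subset)
    moreover have "submatrix H I J \<in> carrier_mat m m"
      using dim I J by (intro submatrix_carrier) auto
    ultimately show "det (submatrix A UNIV J) * det (submatrix (transpose_mat A) J UNIV)
        = (det (submatrix H I J))\<^sup>2"
      by (simp add: det_transpose power2_eq_square)
  qed
  finally show ?thesis by simp
qed

text \<open>The squares of all minors are summed in two ways: each row set contributes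
  \<open>n ^ m\<close>, and each nonzero minor contributes \<open>c\<close>. The premise
  \<open>nonzero\<close> isolates what depends on the particular order \<open>m\<close>.\<close>

lemma hadamard_num_zero_minors:
  assumes H: "hadamard_matrix n H"
    and nonzero: "\<And>M. M \<in> carrier_mat m m \<Longrightarrow> (\<forall>i<m. \<forall>j<m. M $$ (i, j) \<in> {1, -1})
      \<Longrightarrow> det M \<noteq> 0 \<Longrightarrow> (det M)\<^sup>2 = c"
  shows "c * real (num_zero_minors m H) = real (n choose m) * (c * real (n choose m) - real n ^ m)"
proof -
  have dim: "H \<in> carrier_mat n n" and ent: "\<And>i j. i < n \<Longrightarrow> j < n \<Longrightarrow> H $$ (i, j) \<in> {1, -1}"
    using H by (auto simp: hadamard_matrix_def)
  let ?K = "{J. J \<subseteq> {..<n} \<and> card J = m}"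
  let ?f = "\<lambda>I J. det (submatrix H I J)"
  have fin: "finite ?K" by simp
  have cK: "card ?K = n choose m" using n_subsets[of "{..<n}" m] by simp
  have pos: "minor_positions m H = ?K \<times> ?K" using dim by (auto simp: minor_positions_def)
  \<comment> \<open>The indicator makes the sum of squares linear in the number of zero
    minors.\<close>
  have val: "(?f I J)\<^sup>2 = c * (1 - of_bool (?f I J = 0))" if "I \<in> ?K" "J \<in> ?K" for I J
  proof -
    have M: "submatrix H I J \<in> carrier_mat m m" using that dim by (intro submatrix_carrier) auto
    have "{i. i < n \<and> i \<in> I} = I" "{j. j < n \<and> j \<in> J} = J" using that by auto
    then have "\<forall>i<m. \<forall>j<m. submatrix H I J $$ (i, j) \<in> {1, -1}"
      using that dim ent by (auto simp: submatrix_index pick_le_of_subset)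
    then show ?thesis using nonzero[OF M] by auto
  qed
  have "real (n choose m) * real n ^ m = (\<Sum>I\<in>?K. \<Sum>J\<in>?K. (?f I J)\<^sup>2)"
    using hadamard_sum_minors_squared[OF H] cK by simp
  also have "\<dots> = (\<Sum>(I, J)\<in>?K \<times> ?K. c * (1 - of_bool (?f I J = 0)))"
    using val by (simp add: sum.cartesian_product)
  also have "\<dots> = c * (real (card (?K \<times> ?K)) - (\<Sum>(I, J)\<in>?K \<times> ?K. of_bool (?f I J = 0)))"
    by (simp add: case_prod_unfold sum_distrib_left[symmetric] sum_subtractf)
  also have "(\<Sum>(I, J)\<in>?K \<times> ?K. of_bool (?f I J = 0)) = real (num_zero_minors m H)"
  proof -
    have "(\<Sum>x\<in>?K \<times> ?K. of_bool (?f (fst x) (snd x) = 0))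
      = real (card ((?K \<times> ?K) \<inter> {x. ?f (fst x) (snd x) = 0}))"
      using fin by (intro sum_of_bool_eq) auto
    also have "(?K \<times> ?K) \<inter> {x. ?f (fst x) (snd x) = 0} = {(I, J) \<in> minor_positions m H. ?f I J = 0}"
      unfolding pos by auto
    finally show ?thesis by (simp add: case_prod_unfold num_zero_minors_def)
  qed
  finally show ?thesis by (simp add: cK card_cartesian_product algebra_simps)
qed

section \<open>Determinants of small sign matrices\<close>

lemma det_2x2:
  assumes "M \<in> carrier_mat 2 2"
  shows "det M = M $$ (0, 0) * M $$ (1, 1) - M $$ (0, 1) * M $$ (1, 0)"
  using assms
  by (subst laplace_expansion_column[OF assms, of 0])
    (auto simp: numeral_2_eq_2 cofactor_def det_single mat_delete_def)

lemma det_3x3: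
  assumes "M \<in> carrier_mat 3 3"
  shows "det M = M $$ (0, 0) * M $$ (1, 1) * M $$ (2, 2) + M $$ (0, 1) * M $$ (1, 2) * M $$ (2, 0)
    + M $$ (0, 2) * M $$ (1, 0) * M $$ (2, 1) - (M $$ (0, 2) * M $$ (1, 1) * M $$ (2, 0)
    + M $$ (0, 0) * M $$ (1, 2) * M $$ (2, 1) + M $$ (0, 1) * M $$ (1, 0) * M $$ (2, 2))"
proof -
  have del: "mat_delete M i 0 \<in> carrier_mat 2 2" for i
    using assms by (auto simp: mat_delete_def)
  have "det M = (\<Sum>i<3. M $$ (i, 0) * cofactor M i 0)"
    using assms by (rule laplace_expansion_column) simp
  also have "\<dots> = M $$ (0, 0) * det (mat_delete M 0 0) - M $$ (1, 0) * det (mat_delete M 1 0)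
      + M $$ (2, 0) * det (mat_delete M 2 0)"
    by (simp add: cofactor_def numeral_3_eq_3 numeral_2_eq_2)
  finally show ?thesis
    unfolding det_2x2[OF del] using assms
    by (simp add: mat_delete_def numeral_2_eq_2 algebra_simps)
qed

text \<open>The two terms of the expansion are signs, so their difference is 0, 2 or -2.\<close>

lemma det_2x2_sign_squared:
  fixes M :: "real mat"
  assumes "M \<in> carrier_mat 2 2" "\<forall>i<2. \<forall>j<2. M $$ (i, j) \<in> {1, -1}" "det M \<noteq> 0"
  shows "(det M)\<^sup>2 = 4"
proof -
  have "M $$ (i, j) = 1 \<or> M $$ (i, j) = -1" if "i < 2" "j < 2" for i j using assms(2) that by auto
  from this[of 0 0] this[of 0 1] this[of 1 0] this[of 1 1] assms(3)
  show ?thesis unfolding det_2x2[OF assms(1)] by auto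
qed

text \<open>
  The three even and the three odd terms of the expansion have the same product, namely the
  product of all entries.
\<close>
lemma det_3x3_sign_squared:
  fixes M :: "real mat"
  assumes "M \<in> carrier_mat 3 3" "\<forall>i<3. \<forall>j<3. M $$ (i, j) \<in> {1, -1}" "det M \<noteq> 0"
  shows "(det M)\<^sup>2 = 16"
proof -
  define p1 p2 p3 where p: "p1 = M $$ (0, 0) * M $$ (1, 1) * M $$ (2, 2)"
    "p2 = M $$ (0, 1) * M $$ (1, 2) * M $$ (2, 0)" "p3 = M $$ (0, 2) * M $$ (1, 0) * M $$ (2, 1)"
  define q1 q2 q3 where q: "q1 = M $$ (0, 2) * M $$ (1, 1) * M $$ (2, 0)"
    "q2 = M $$ (0, 0) * M $$ (1, 2) * M $$ (2, 1)" "q3 = M $$ (0, 1) * M $$ (1, 0) * M $$ (2, 2)"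
  have prod: "p1 * p2 * p3 = q1 * q2 * q3" by (simp add: p q mult_ac)
  have det: "det M = p1 + p2 + p3 - (q1 + q2 + q3)"
    unfolding p q by (rule det_3x3[OF assms(1)])
  have sign: "x * y * z = 1 \<or> x * y * z = -1"
    if "x \<in> {1, -1}" "y \<in> {1, -1}" "z \<in> {1, -1}" for x y z :: real
    using that by auto
  have "p1 = 1 \<or> p1 = -1" "p2 = 1 \<or> p2 = -1" "p3 = 1 \<or> p3 = -1"
    "q1 = 1 \<or> q1 = -1" "q2 = 1 \<or> q2 = -1" "q3 = 1 \<or> q3 = -1"
    unfolding p q by (intro sign assms(2)[rule_format]; simp)+
  \<comment> \<open>Equal products mean equal parity of the number of -1s, so both sums lie in {3,
    -1} or both in {-3, 1}. Their difference is therefore 0, 4 or -4.\<close>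
  then show ?thesis using prod assms(3) unfolding det by auto
qed

section \<open>Binomial coefficients and the final count\<close>

lemma real_choose_two: "real (n choose 2) = real n * (real n - 1) / 2"
  by (simp add: binomial_gbinomial gbinomial_prod_rev numeral_2_eq_2)

lemma real_choose_three: "real (n choose 3) = real n * (real n - 1) * (real n - 2) / 6"
  by (simp add: binomial_gbinomial gbinomial_prod_rev numeral_3_eq_3 fact_numeral)

theorem corollary4:
  fixes H :: "real mat" and n :: nat
  assumes "hadamard_matrix n H"
  shows "real (num_zero_minors 2 H) = (real n)^2 * (real n - 1) * (real n - 2) / 8
    \<and> real (num_zero_minors 3 H)
        = (real n)^2 * (real n - 1) * (real n - 2) * (real n - 4) * (5 * real n - 4) / 288"
proof
  have "4 * real (num_zero_minors 2 H) = real (n choose 2) * (4 * real (n choose 2) - real n ^ 2)"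
    using hadamard_num_zero_minors[OF assms det_2x2_sign_squared] .
  \<comment> \<open>The second factor is 2n(n - 1) - n^2 = n(n - 2).\<close>
  then show "real (num_zero_minors 2 H) = (real n)^2 * (real n - 1) * (real n - 2) / 8"
    by (simp add: real_choose_two field_simps power2_eq_square)
  have "16 * real (num_zero_minors 3 H) = real (n choose 3) * (16 * real (n choose 3) - real n ^ 3)"
    using hadamard_num_zero_minors[OF assms det_3x3_sign_squared] .
  \<comment> \<open>The second factor is n(5n^2 - 24n + 16)/3 = n(n - 4)(5n - 4)/3, and 288 = 6 * 3
    * 16.\<close>
  then show "real (num_zero_minors 3 H)
      = (real n)^2 * (real n - 1) * (real n - 2) * (real n - 4) * (5 * real n - 4) / 288"
    by (simp add: real_choose_three field_simps power2_eq_square power3_eq_cube)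
qed

end
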